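(* Let $G$ be a connected graph of order at least $3$ that is not isomorphic to the cycle $C_5$. Then there exists a partition $(A_1,A_2,A_3)$ of $V(G)$ such that the set $$\mathcal{X} = \bigcup_{i=1}^{3} \bigl( V(G) - N[A_i] \bigr)$$ is an independent set of $G$.
   Context: All graphs are finite and simple. For a set $A$ of vertices, $N[A]$ denotes the closed neighborhood of $A$, i.e., $A$ together with all vertices adjacent to some vertex of $A$. *)

theory Defs
  imports "Graph_Theory.Graph_Theory" "HOL-Library.Disjoint_Sets"
begin

text \<open>
  A finite simple graph is an instance of the locale \<^locale>\<open>graph\<close>: a finite symmetric digraph
  without loops and without parallel arcs.  An undirected edge is the corresponding pair of
  opposite arcs, so adjacency is the relation \<^const>\<open>dominates\<close>.
\<close>

definition closed_neighborhood :: "('a, 'b) pre_digraph \<Rightarrow> 'a set \<Rightarrow> 'a set" where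
  "closed_neighborhood G A = A \<union> {v. \<exists>u\<in>A. u \<rightarrow>\<^bsub>G\<^esub> v}"

definition independent_set :: "('a, 'b) pre_digraph \<Rightarrow> 'a set \<Rightarrow> bool" where
  "independent_set G S \<longleftrightarrow> S \<subseteq> verts G \<and> (\<forall>u\<in>S. \<forall>v\<in>S. \<not> u \<rightarrow>\<^bsub>G\<^esub> v)"

text \<open>The cycle on the vertices \<open>0, \<dots>, n - 1\<close>; it is only meaningful for \<open>n \<ge> 3\<close>.\<close>

definition cycle_graph :: "nat \<Rightarrow> nat pair_pre_digraph" where
  "cycle_graph n =
     \<lparr> pverts = {..<n},
       parcs = {(i, j). i < n \<and> j < n \<and> (j = (i + 1) mod n \<or> i = (j + 1) mod n)} \<rparr>"

lemma graph_cycle_graph: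
  assumes "n \<ge> 3"
  shows "graph (with_proj (cycle_graph n))"
proof -
  have ne: "Suc i mod n \<noteq> i" if "i < n" for i
    using that assms by (cases "Suc i = n") auto
  have "finite (parcs (cycle_graph n))"
    by (rule finite_subset[of _ "{..<n} \<times> {..<n}"]) (auto simp: cycle_graph_def)
  then have "pair_graph (cycle_graph n)"
    by unfold_locales
       (use ne ne[symmetric] in \<open>auto simp: cycle_graph_def symmetric_def sym_def\<close>)
  then show ?thesis
    by (rule pair_graph.pair_graphD_graph)
qed

end

theory Submission
  imports Defs
begin

text \<open>
  Color the vertices with 0, 1, 2 and call a vertex rainbow if all colors occur in its closed
  neighborhood; it suffices that every edge has a rainbow end. Take a longest path. If its ends are
  not adjacent, run a depth-first search from one end along the path: with suitable colors only the
  leaves of the search tree and its root fail to be rainbow, the leaves are pairwise nonadjacent, and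
  the neighbors of the root are inner vertices of the path. If the ends are adjacent, the path closes
  up to a Hamiltonian cycle of length \<open>n\<close>. Coloring it periodically (up to the color
  of the last vertex) works unless \<open>n mod 3 = 2\<close>, and
  even then if some chord joins vertices whose distance along the cycle is not 1 modulo 3; for
  \<open>n = 5\<close> every chord is of this kind. For \<open>n \<ge> 8\<close> a coloring that reverses direction at positions
  0 and 4 works unless these are adjacent; if all vertices at distance 4 are adjacent, rerouting the
  cycle through two such chords produces a chord of the required kind.
\<close>

unbundle no funcset_syntax

section \<open>Residues modulo 3\<close>

lemma mod_3_distinct:
  fixes i :: nat
  shows "i mod 3 \<noteq> Suc i mod 3" "i mod 3 \<noteq> Suc (Suc i) mod 3" "Suc i mod 3 \<noteq> Suc (Suc i) mod 3"
  by (auto simp: mod_Suc)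

lemma mod_3_pred:
  fixes n :: nat
  assumes "2 \<le> n"
  shows mod_3_pred_eq_2: "n mod 3 = 0 \<Longrightarrow> (n - 1) mod 3 = 2" "n mod 3 = 0 \<Longrightarrow> (n - 2) mod 3 = 1"
    and mod_3_pred_eq_0: "n mod 3 = 1 \<Longrightarrow> (n - 1) mod 3 = 0" "n mod 3 = 1 \<Longrightarrow> (n - 2) mod 3 = 2"
    and mod_3_pred_eq_1: "n mod 3 = 2 \<Longrightarrow> (n - 1) mod 3 = 1" "n mod 3 = 2 \<Longrightarrow> (n - 2) mod 3 = 0"
proof -
  obtain i where i: "n = Suc (Suc i)" using assms by (metis add_2_eq_Suc le_Suc_ex)
  have lt: "i mod 3 < 3" by simp
  show "n mod 3 = 0 \<Longrightarrow> (n - 1) mod 3 = 2" "n mod 3 = 0 \<Longrightarrow> (n - 2) mod 3 = 1"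
    "n mod 3 = 1 \<Longrightarrow> (n - 1) mod 3 = 0" "n mod 3 = 1 \<Longrightarrow> (n - 2) mod 3 = 2"
    "n mod 3 = 2 \<Longrightarrow> (n - 1) mod 3 = 1" "n mod 3 = 2 \<Longrightarrow> (n - 2) mod 3 = 0"
    unfolding i using lt by (auto simp: mod_Suc split: if_splits)
qed

context graph
begin

section \<open>Rainbow vertices and good colorings\<close>

definition rainbow :: "('a \<Rightarrow> nat) \<Rightarrow> 'a \<Rightarrow> bool" where
  "rainbow c v \<longleftrightarrow> (\<forall>k<3. \<exists>w. (w = v \<or> v \<rightarrow> w) \<and> c w = k)"

definition good_coloring :: "('a \<Rightarrow> nat) \<Rightarrow> bool" where
  "good_coloring c \<longleftrightarrow> (\<forall>u v. u \<rightarrow> v \<longrightarrow> rainbow c u \<or> rainbow c v)"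

lemma adj_sym: "u \<rightarrow> v \<Longrightarrow> v \<rightarrow> u"
  by (rule graph_symmetric)

lemma rainbowI:
  assumes "v \<rightarrow> a" "v \<rightarrow> b" "c v < 3" "c a < 3" "c b < 3" "c v \<noteq> c a" "c v \<noteq> c b" "c a \<noteq> c b"
  shows "rainbow c v"
  unfolding rainbow_def
proof (intro allI impI)
  fix k :: nat assume "k < 3"
  with assms(3-) have "k = c v \<or> k = c a \<or> k = c b" by linarith
  with assms(1,2) show "\<exists>w. (w = v \<or> v \<rightarrow> w) \<and> c w = k" by auto
qed

lemma rainbow_cong:
  assumes "rainbow c v" "c' v = c v" "\<And>w. v \<rightarrow> w \<Longrightarrow> c' w = c w"
  shows "rainbow c' v"
  using assms unfolding rainbow_def by metis

text \<open>There are no loops, so only an edge between the two exceptional vertices could lack a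
  rainbow end. The case \<open>a = b\<close> is allowed and serves when at most one vertex is in
  doubt.\<close>

lemma good_coloringI:
  assumes "\<And>x. x \<in> verts G \<Longrightarrow> x = a \<or> x = b \<or> rainbow c x"
    and "a \<rightarrow> b \<Longrightarrow> rainbow c a \<or> rainbow c b"
  shows "good_coloring c"
  unfolding good_coloring_def
proof (intro allI impI)
  fix u v assume uv: "u \<rightarrow> v"
  show "rainbow c u \<or> rainbow c v"
    using assms(1)[OF adj_in_verts(1)[OF uv]] assms(1)[OF adj_in_verts(2)[OF uv]]
      assms(2) uv adj_sym[OF uv] adj_not_same by blast
qed

lemma connected_closed:
  assumes "connected G" "S \<subseteq> verts G" "x \<in> S" "\<And>u v. u \<in> S \<Longrightarrow> u \<rightarrow> v \<Longrightarrow> v \<in> S"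
  shows "S = verts G"
proof
  show "verts G \<subseteq> S"
  proof
    fix y assume y: "y \<in> verts G"
    have "x \<rightarrow>\<^sup>*\<^bsub>mk_symmetric G\<^esub> y"
      using assms(1-3) y unfolding connected_def strongly_connected_def by auto
    then have "x \<rightarrow>\<^sup>* y"
      using reachable_mk_symmetric_eq[OF sym_arcs] by simp
    then show "y \<in> S"
      by (induction rule: reachable_induct) (use assms(3,4) in auto)
  qed
qed (rule assms)

section \<open>Coloring by depth-first search\<close>

text \<open>\<open>W\<close> collects the vertices newly visited from \<open>v\<close>, while
  \<open>v\<close> itself is colored beforehand. The fourth conjunct expresses that the search is
  exhaustive. The last vertex of \<open>v # vs\<close> is exempt from the final conjunct because it
  may become a leaf.\<close>

definition dfs_extension :: "'a set \<Rightarrow> 'a \<Rightarrow> ('a \<Rightarrow> nat) \<Rightarrow> 'a list \<Rightarrow> 'a set \<Rightarrow> ('a \<Rightarrow> nat) \<Rightarrow> bool" where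
  "dfs_extension U v c vs W c' \<longleftrightarrow> W \<subseteq> U \<and> set vs \<subseteq> W \<and> (\<forall>x. x \<notin> W \<longrightarrow> c' x = c x) \<and>
    (\<forall>x\<in>insert v W. \<forall>y. x \<rightarrow> y \<longrightarrow> y \<notin> U - W) \<and>
    (\<forall>x\<in>insert v W. \<forall>y\<in>insert v W. x \<rightarrow> y \<longrightarrow> rainbow c' x \<or> rainbow c' y) \<and>
    (\<forall>x\<in>set (butlast (v # vs)). rainbow c' x)"

lemma dfs_extensionD:
  assumes "dfs_extension U v c vs W c'"
  shows "W \<subseteq> U" "set vs \<subseteq> W" "x \<notin> W \<Longrightarrow> c' x = c x"
    "x \<in> insert v W \<Longrightarrow> x \<rightarrow> y \<Longrightarrow> y \<notin> U - W"
    "x \<in> insert v W \<Longrightarrow> y \<in> insert v W \<Longrightarrow> x \<rightarrow> y \<Longrightarrow> rainbow c' x \<or> rainbow c' y"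
    "x \<in> set (butlast (v # vs)) \<Longrightarrow> rainbow c' x"
  using assms unfolding dfs_extension_def by blast+

text \<open>
  A depth-first search colors the unvisited set \<open>U\<close> from \<open>v\<close>, whose parent is \<open>p\<close>, giving each
  child the color that is missing at its parent and grandparent, so that only leaves fail to be
  rainbow. Descending along \<open>vs\<close> first keeps the leaves off the inner vertices of that path.
\<close>
lemma ex_dfs_extension:
  assumes "finite U" "v \<notin> U" "p \<notin> U" "v \<rightarrow> p" "c p < 3" "c v < 3" "c p \<noteq> c v"
    and "distinct (v # vs)" "set vs \<subseteq> U" "successively (dominates G) (v # vs)"
  shows "\<exists>W c'. dfs_extension U v c vs W c'"
  using assms
proof (induction "card U" arbitrary: U v p c vs rule: less_induct)
  case less
  note prems = less.prems
  show ?case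
  proof (cases "\<exists>w\<in>U. v \<rightarrow> w")
    case False
    then have "vs = []"
      using prems(9,10) by (cases vs) auto
    then have "dfs_extension U v c vs {} c"
      using False adj_not_same by (auto simp: dfs_extension_def)
    then show ?thesis by blast
  next
    case True
    \<comment> \<open>The first child \<open>w\<close> is the next vertex of the prescribed path if
      there is one, and any neighbor in \<open>U\<close> otherwise.\<close>
    obtain w ws where w: "w \<in> U" "v \<rightarrow> w" "distinct (w # ws)" "set ws \<subseteq> U - {w}"
      "successively (dominates G) (w # ws)" "vs \<noteq> [] \<Longrightarrow> vs = w # ws"
    proof (cases vs)
      case Nil
      then show ?thesis using True that[of _ "[]"] by auto
    next
      case (Cons w ws)
      show ?thesis by (rule that[of w ws]) (use Cons prems(8-10) in auto)
    qed
    have "\<exists>k<3. k \<noteq> c p \<and> k \<noteq> c v" by presburger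
    then obtain k where k: "k < 3" "k \<noteq> c p" "k \<noteq> c v" by blast
    define c1 where "c1 = c(w := k)"
    have wv: "w \<noteq> v" and wp: "w \<noteq> p" using w(1) prems(2,3) by auto
    have card1: "card (U - {w}) < card U" using w(1) prems(1) by (meson card_Diff1_less)
    have "\<exists>W c'. dfs_extension (U - {w}) w c1 ws W c'"
      by (rule less.hyps[OF card1, of w v c1 ws])
         (use prems(1-3,5-7) w(3-5) k wv adj_sym[OF w(2)] in \<open>auto simp: c1_def\<close>)
    then obtain W1 c2 where ext1: "dfs_extension (U - {w}) w c1 ws W1 c2" by blast
    note W1 = dfs_extensionD[OF ext1]
    \<comment> \<open>What the search from \<open>w\<close> leaves unvisited is searched from
      \<open>v\<close> again, with the same parent \<open>p\<close> and no path to follow. This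
      covers the remaining children of \<open>v\<close>.\<close>
    define U2 where "U2 = U - {w} - W1"
    have out1: "w \<notin> W1" "v \<notin> W1" "p \<notin> W1" using W1(1) prems(2,3) by auto
    have col2: "c2 w = k" "c2 v = c v" "c2 p = c p"
      using W1(3) out1 wv wp by (simp_all add: c1_def)
    have card2: "card U2 < card U"
      unfolding U2_def using card1 prems(1) by (meson Diff_subset card_mono finite_Diff le_less_trans)
    have "\<exists>W c'. dfs_extension U2 v c2 [] W c'"
      by (rule less.hyps[OF card2, of v p c2 "[]"])
         (use prems(1-7) col2 in \<open>auto simp: U2_def\<close>)
    then obtain W2 c3 where ext2: "dfs_extension U2 v c2 [] W2 c3" by blast
    note W2 = dfs_extensionD(1,3-5)[OF ext2]
    have out2: "v \<notin> W2" "p \<notin> W2" "w \<notin> W2" using W2(1) prems(2,3) by (auto simp: U2_def)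
    \<comment> \<open>The first search left no edge from \<open>insert w W1\<close> into
      \<open>U2\<close>, so the second one changes no color in the closed neighborhoods of these
      vertices.\<close>
    have keep: "rainbow c3 x" if "x \<in> insert w W1" "rainbow c2 x" for x
    proof (rule rainbow_cong[OF that(2)])
      show "c3 x = c2 x" using that(1) W2(1,2) by (auto simp: U2_def)
      show "c3 y = c2 y" if "x \<rightarrow> y" for y
        using W1(4)[OF \<open>x \<in> insert w W1\<close> that] W2(1,2) by (auto simp: U2_def)
    qed
    \<comment> \<open>The parent \<open>p\<close> and the first child \<open>w\<close> supply the
      two colors that \<open>v\<close> does not have itself.\<close>
    have v3: "rainbow c3 v"
    proof (rule rainbowI[OF prems(4) w(2)])
      have "c3 v = c v" "c3 p = c p" "c3 w = k"
        using W2(2) col2 out2 by simp_all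
      then show "c3 v < 3" "c3 p < 3" "c3 w < 3" "c3 v \<noteq> c3 p" "c3 v \<noteq> c3 w" "c3 p \<noteq> c3 w"
        using prems(5-7) k by simp_all
    qed
    define W where "W = insert w W1 \<union> W2"
    have "W \<subseteq> U" using W1(1) W2(1) w(1) by (auto simp: W_def U2_def)
    moreover have "set vs \<subseteq> W"
      using w(6) W1(2) by (cases "vs = []") (auto simp: W_def)
    moreover have "c3 x = c x" if "x \<notin> W" for x
      using that W1(3) W2(2) by (auto simp: W_def c1_def)
    moreover have "y \<notin> U - W" if "x \<in> insert v W" "x \<rightarrow> y" for x y
      using that W1(4) W2(3) unfolding W_def U2_def by blast
    moreover have "rainbow c3 x \<or> rainbow c3 y"
      if "x \<in> insert v W" "y \<in> insert v W" "x \<rightarrow> y" for x y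
    proof -
      \<comment> \<open>As in any depth-first search of an undirected graph, there are no cross
        edges between different subtrees.\<close>
      have sep: False if "x \<in> insert w W1" "y \<in> W2" "x \<rightarrow> y" for x y
        using W1(4)[OF that(1,3)] that(2) W2(1) by (auto simp: U2_def)
      consider "x = v \<or> y = v" | "x \<in> insert w W1" "y \<in> insert w W1" | "x \<in> W2" "y \<in> W2"
        using \<open>x \<in> insert v W\<close> \<open>y \<in> insert v W\<close> sep[of x y] sep[of y x] \<open>x \<rightarrow> y\<close> adj_sym[of x y]
        unfolding W_def by blast
      then show ?thesis
        using v3 keep W1(5) W2(4) \<open>x \<rightarrow> y\<close> by cases blast+
    qed
    moreover have "rainbow c3 x" if x: "x \<in> set (butlast (v # vs))" for x
    proof (cases "x = v")
      case False
      with x have "vs \<noteq> []" by (auto split: if_splits)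
      with False x w(6) have "x \<in> set (butlast (w # ws))" by auto
      moreover have "x \<in> insert w W1"
        using in_set_butlastD[OF calculation] W1(2) by auto
      ultimately show ?thesis using keep W1(6) by blast
    qed (simp add: v3)
    ultimately have "dfs_extension U v c vs W c3"
      unfolding dfs_extension_def by blast
    then show ?thesis by blast
  qed
qed

section \<open>Hamiltonian cycles and colorings by position\<close>

text \<open>A single vertex is excluded, since the closing arc would be a loop, but two adjacent
  vertices do form such a list. Being an actual cycle takes the separate bound
  \<open>length xs \<ge> 3\<close>.\<close>

definition hamiltonian_cycle :: "'a list \<Rightarrow> bool" where
  "hamiltonian_cycle xs \<longleftrightarrow> distinct xs \<and> set xs = verts G \<and> xs \<noteq> [] \<and>
     successively (dominates G) xs \<and> last xs \<rightarrow> hd xs"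

lemma successively_dominates_nth:
  "successively (dominates G) xs \<Longrightarrow> Suc i < length xs \<Longrightarrow> xs ! i \<rightarrow> xs ! Suc i"
proof (induction xs arbitrary: i)
  case (Cons x xs)
  then show ?case by (cases i) (auto simp: successively_Cons hd_conv_nth)
qed simp

lemma hamiltonian_cycle_nth_Suc:
  "hamiltonian_cycle xs \<Longrightarrow> Suc i < length xs \<Longrightarrow> xs ! i \<rightarrow> xs ! Suc i"
  unfolding hamiltonian_cycle_def by (auto intro: successively_dominates_nth)

lemma hamiltonian_cycle_close:
  "hamiltonian_cycle xs \<Longrightarrow> xs ! (length xs - 1) \<rightarrow> xs ! 0"
  unfolding hamiltonian_cycle_def by (metis last_conv_nth hd_conv_nth)

text \<open>Lets a chosen vertex, such as an end of a chord, be moved to position 0.\<close>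

lemma hamiltonian_cycle_rotate:
  assumes "hamiltonian_cycle xs"
  shows "hamiltonian_cycle (rotate k xs)"
proof (induction k)
  case (Suc k)
  have "hamiltonian_cycle (rotate1 ys)" if "hamiltonian_cycle ys" for ys
    using that unfolding hamiltonian_cycle_def
    by (cases ys) (auto simp: successively_append_iff successively_Cons split: if_splits)
  with Suc show ?case by simp
qed (simp add: assms)

lemma hamiltonian_cycle_coloring:
  assumes "hamiltonian_cycle xs"
  shows "\<exists>c. \<forall>i<length xs. c (xs ! i) = g i"
proof (intro exI allI impI)
  fix i assume "i < length xs"
  moreover have "inj_on ((!) xs) {..<length xs}"
    using assms by (auto simp: hamiltonian_cycle_def inj_on_nth)
  ultimately show "(g \<circ> the_inv_into {..<length xs} ((!) xs)) (xs ! i) = g i"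
    by (simp add: the_inv_into_f_f)
qed

lemma hamiltonian_cycle_rainbow:
  assumes "hamiltonian_cycle xs" and c: "\<And>i. i < length xs \<Longrightarrow> c (xs ! i) = g i"
    and g: "g i < 3" "g (Suc i) < 3" "g (Suc (Suc i)) < 3"
    and d: "g i \<noteq> g (Suc i)" "g i \<noteq> g (Suc (Suc i))" "g (Suc i) \<noteq> g (Suc (Suc i))"
    and "Suc (Suc i) < length xs"
  shows "rainbow c (xs ! Suc i)"
proof (rule rainbowI)
  show "xs ! Suc i \<rightarrow> xs ! i"
    by (rule adj_sym) (use assms(1,9) hamiltonian_cycle_nth_Suc in auto)
  show "xs ! Suc i \<rightarrow> xs ! Suc (Suc i)"
    using assms(1,9) hamiltonian_cycle_nth_Suc by auto
qed (use assms(3-9) in \<open>auto simp: c\<close>)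

text \<open>List positions do not wrap around, so the two ends of the closing edge get their own
  versions of the preceding criterion, here and in the next lemma.\<close>

lemma hamiltonian_cycle_rainbow_0:
  assumes "hamiltonian_cycle xs" and c: "\<And>i. i < length xs \<Longrightarrow> c (xs ! i) = g i"
    and "g 0 < 3" "g 1 < 3" "g (length xs - 1) < 3"
    and "g 0 \<noteq> g 1" "g 0 \<noteq> g (length xs - 1)" "g 1 \<noteq> g (length xs - 1)"
    and "1 < length xs"
  shows "rainbow c (xs ! 0)"
proof (rule rainbowI)
  show "xs ! 0 \<rightarrow> xs ! 1" "xs ! 0 \<rightarrow> xs ! (length xs - 1)"
    using assms(1,9) hamiltonian_cycle_nth_Suc[of xs 0] adj_sym[OF hamiltonian_cycle_close] by auto
  have "c (xs ! 0) = g 0" "c (xs ! 1) = g 1" "c (xs ! (length xs - 1)) = g (length xs - 1)"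
    using assms(9) by (auto intro!: c)
  with assms(3-8) show "c (xs ! 0) < 3" "c (xs ! 1) < 3" "c (xs ! (length xs - 1)) < 3"
    "c (xs ! 0) \<noteq> c (xs ! 1)" "c (xs ! 0) \<noteq> c (xs ! (length xs - 1))"
    "c (xs ! 1) \<noteq> c (xs ! (length xs - 1))"
    by presburger+
qed

lemma hamiltonian_cycle_rainbow_last:
  assumes "hamiltonian_cycle xs" and c: "\<And>i. i < length xs \<Longrightarrow> c (xs ! i) = g i"
    and "g 0 < 3" "g (length xs - 1) < 3" "g (length xs - 2) < 3"
    and "g (length xs - 1) \<noteq> g 0" "g (length xs - 1) \<noteq> g (length xs - 2)" "g 0 \<noteq> g (length xs - 2)"
    and "1 < length xs"
  shows "rainbow c (xs ! (length xs - 1))"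
proof (rule rainbowI)
  have "Suc (length xs - 2) = length xs - 1" using assms(9) by auto
  then show "xs ! (length xs - 1) \<rightarrow> xs ! 0" "xs ! (length xs - 1) \<rightarrow> xs ! (length xs - 2)"
    using assms(1,9) adj_sym[OF hamiltonian_cycle_nth_Suc[of xs "length xs - 2"]]
      hamiltonian_cycle_close by auto
  have "c (xs ! 0) = g 0" "c (xs ! (length xs - 1)) = g (length xs - 1)"
    "c (xs ! (length xs - 2)) = g (length xs - 2)"
    using assms(9) by (auto intro!: c)
  with assms(3-8) show "c (xs ! (length xs - 1)) < 3" "c (xs ! 0) < 3" "c (xs ! (length xs - 2)) < 3"
    "c (xs ! (length xs - 1)) \<noteq> c (xs ! 0)" "c (xs ! (length xs - 1)) \<noteq> c (xs ! (length xs - 2))"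
    "c (xs ! 0) \<noteq> c (xs ! (length xs - 2))"
    by presburger+
qed

lemma hamiltonian_cycle_good_coloringI:
  assumes "hamiltonian_cycle xs" "a < length xs" "b < length xs"
    and "\<And>i. i < length xs \<Longrightarrow> i \<noteq> a \<Longrightarrow> i \<noteq> b \<Longrightarrow> rainbow c (xs ! i)"
    and "xs ! a \<rightarrow> xs ! b \<Longrightarrow> rainbow c (xs ! a) \<or> rainbow c (xs ! b)"
  shows "good_coloring c"
proof (rule good_coloringI[of "xs ! a" "xs ! b"])
  fix x assume "x \<in> verts G"
  then obtain i where "i < length xs" "x = xs ! i"
    using assms(1) unfolding hamiltonian_cycle_def by (metis in_set_conv_nth)
  with assms(4) show "x = xs ! a \<or> x = xs ! b \<or> rainbow c x" by blast
qed (rule assms(5))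

section \<open>Hamiltonian graphs by order modulo 3\<close>

lemma good_coloring_mod_3_eq_0:
  assumes "hamiltonian_cycle xs" "length xs mod 3 = 0"
  shows "\<exists>c. good_coloring c"
proof -
  let ?n = "length xs"
  have n: "2 \<le> ?n" "1 < ?n"
    using assms unfolding hamiltonian_cycle_def by (cases "?n < 3"; auto)+
  note ends = mod_3_pred_eq_2[OF n(1) assms(2)]
  obtain c where "\<forall>i<?n. c (xs ! i) = i mod 3"
    using hamiltonian_cycle_coloring[OF assms(1), of "\<lambda>i. i mod 3"] ..
  then have c: "\<And>i. i < ?n \<Longrightarrow> c (xs ! i) = i mod 3" by simp
  have "rainbow c (xs ! 0)"
    by (rule hamiltonian_cycle_rainbow_0[where c = c and g = "\<lambda>i. i mod 3", OF assms(1)])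
       (simp_all add: c ends[simplified] n[simplified])
  moreover have "rainbow c (xs ! (?n - 1))"
    by (rule hamiltonian_cycle_rainbow_last[where c = c and g = "\<lambda>i. i mod 3", OF assms(1)])
       (simp_all add: c ends[simplified] n[simplified])
  moreover have "rainbow c (xs ! i)" if i: "i < ?n" "i \<noteq> 0" "i \<noteq> ?n - 1" for i
  proof -
    obtain j where j: "i = Suc j" using i(2) by (cases i) auto
    have "Suc (Suc j) < ?n" using i j by linarith
    then show ?thesis unfolding j
      by (intro hamiltonian_cycle_rainbow[where c = c and g = "\<lambda>i. i mod 3", OF assms(1)])
         (simp_all add: c mod_3_distinct)
  qed
  ultimately have all: "rainbow c (xs ! i)" if "i < ?n" for i
    using that by metis
  have "0 < ?n" using n by linarith
  then have "good_coloring c"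
    by (intro hamiltonian_cycle_good_coloringI[OF assms(1), of 0 0]) (auto intro: all)
  then show ?thesis by blast
qed

text \<open>Giving the last vertex color 1 instead of 0 leaves only positions 0 and
  \<open>length xs - 2\<close> in doubt. They have colors 0 and 2, and along the cycle each misses
  just the color of the other, so an edge between them makes both rainbow.\<close>

lemma good_coloring_mod_3_eq_1:
  assumes "hamiltonian_cycle xs" "length xs mod 3 = 1" "length xs \<ge> 3"
  shows "\<exists>c. good_coloring c"
proof -
  let ?n = "length xs"
  have n: "2 \<le> ?n" "1 < ?n" "3 < ?n"
    using assms by (cases "?n = 3"; auto)+
  note ends = mod_3_pred_eq_0[OF n(1) assms(2)]
  define g :: "nat \<Rightarrow> nat" where "g i = (if i = ?n - 1 then 1 else i mod 3)" for i
  have g: "g i = i mod 3" if "Suc i < ?n" for i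
    using that by (auto simp: g_def)
  have g_ends: "g 0 = 0" "g 1 = 1" "g (?n - 1) = 1" "g (?n - 2) = 2"
    using n ends by (auto simp: g_def)
  obtain c where "\<forall>i<?n. c (xs ! i) = g i"
    using hamiltonian_cycle_coloring[OF assms(1), of g] ..
  then have c: "\<And>i. i < ?n \<Longrightarrow> c (xs ! i) = g i" by simp
  have r: "rainbow c (xs ! (?n - 1))"
    by (rule hamiltonian_cycle_rainbow_last[where c = c and g = g, OF assms(1)])
       (simp_all add: c g_ends g_ends[simplified] n[simplified])
  have "good_coloring c"
  proof (rule hamiltonian_cycle_good_coloringI[OF assms(1), of 0 "?n - 2"])
    fix i assume i: "i < ?n" "i \<noteq> 0" "i \<noteq> ?n - 2"
    show "rainbow c (xs ! i)"
    proof (cases "i = ?n - 1")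
      case False
      obtain j where j: "i = Suc j" using i(2) by (cases i) auto
      have lt: "Suc (Suc (Suc j)) < ?n" using i j False by linarith
      then have "g j = j mod 3" "g (Suc j) = Suc j mod 3" "g (Suc (Suc j)) = Suc (Suc j) mod 3"
        by (simp_all add: g)
      with lt show ?thesis unfolding j
        by (intro hamiltonian_cycle_rainbow[where c = c and g = g, OF assms(1)])
           (simp_all add: c mod_3_distinct)
    qed (use r in simp)
  next
    assume e: "xs ! 0 \<rightarrow> xs ! (?n - 2)"
    have "rainbow c (xs ! 0)"
    proof (rule rainbowI[OF _ e])
      show "xs ! 0 \<rightarrow> xs ! 1" using hamiltonian_cycle_nth_Suc[OF assms(1), of 0] n(2) by simp
      have "c (xs ! 0) = 0" "c (xs ! 1) = 1" "c (xs ! (?n - 2)) = 2"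
        using c[of 0] c[of 1] c[of "?n - 2"] g_ends n by linarith+
      then show "c (xs ! 0) < 3" "c (xs ! 1) < 3" "c (xs ! (?n - 2)) < 3"
        "c (xs ! 0) \<noteq> c (xs ! 1)" "c (xs ! 0) \<noteq> c (xs ! (?n - 2))"
        "c (xs ! 1) \<noteq> c (xs ! (?n - 2))"
        by linarith+
    qed
    then show "rainbow c (xs ! 0) \<or> rainbow c (xs ! (?n - 2))" ..
  qed (use n in linarith)+
  then show ?thesis by blast
qed

text \<open>In the coloring by \<open>i mod 3\<close> only the first and the last position can fail.
  The chord gives position 0 the missing color 2, and a single failing vertex is harmless.\<close>

lemma good_coloring_chord_0:
  assumes "hamiltonian_cycle xs" "length xs \<ge> 3"
    and "j < length xs" "j mod 3 = 2" "xs ! 0 \<rightarrow> xs ! j"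
  shows "\<exists>c. good_coloring c"
proof -
  let ?n = "length xs"
  obtain c where "\<forall>i<?n. c (xs ! i) = i mod 3"
    using hamiltonian_cycle_coloring[OF assms(1), of "\<lambda>i. i mod 3"] ..
  then have c: "\<And>i. i < ?n \<Longrightarrow> c (xs ! i) = i mod 3" by simp
  have "rainbow c (xs ! 0)"
  proof (rule rainbowI[OF _ assms(5)])
    show "xs ! 0 \<rightarrow> xs ! 1" using hamiltonian_cycle_nth_Suc[OF assms(1), of 0] assms(2) by simp
    have "0 < ?n" "1 < ?n" using assms(2) by linarith+
    then have "c (xs ! 0) = 0" "c (xs ! 1) = 1" "c (xs ! j) = 2"
      using c[of 0] c[of 1] c[OF assms(3)] assms(4) by (simp_all del: length_greater_0_conv)
    then show "c (xs ! 0) < 3" "c (xs ! 1) < 3" "c (xs ! j) < 3"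
      "c (xs ! 0) \<noteq> c (xs ! 1)" "c (xs ! 0) \<noteq> c (xs ! j)" "c (xs ! 1) \<noteq> c (xs ! j)"
      by linarith+
  qed
  moreover have "rainbow c (xs ! i)" if i: "i < ?n" "i \<noteq> 0" "i \<noteq> ?n - 1" for i
  proof -
    obtain j where j: "i = Suc j" using i(2) by (cases i) auto
    have "Suc (Suc j) < ?n" using i j by linarith
    then show ?thesis unfolding j
      by (intro hamiltonian_cycle_rainbow[where c = c and g = "\<lambda>i. i mod 3", OF assms(1)])
         (simp_all add: c mod_3_distinct)
  qed
  ultimately have "good_coloring c"
    by (intro hamiltonian_cycle_good_coloringI[OF assms(1), of 0 "?n - 1"]) (use assms(2) in auto)
  then show ?thesis by blast
qed

text \<open>A chord spanning \<open>d\<close> steps spans \<open>length xs - d\<close> steps the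
  other way around. If 3 divides \<open>d\<close>, this second distance is 2 modulo 3, so the
  previous lemma applies from the other end.\<close>

lemma good_coloring_chord:
  assumes xs: "hamiltonian_cycle xs" and n: "length xs mod 3 = 2" "length xs \<ge> 3"
    and d: "i + d < length xs" "d mod 3 \<noteq> 1" and e: "xs ! i \<rightarrow> xs ! (i + d)"
  shows "\<exists>c. good_coloring c"
proof (cases "d mod 3 = 2")
  case True
  show ?thesis
  proof (rule good_coloring_chord_0[OF hamiltonian_cycle_rotate[OF xs, of i]])
    show "rotate i xs ! 0 \<rightarrow> rotate i xs ! d"
      using d e by (subst (1 2) nth_rotate) auto
  qed (use n d True in auto)
next
  case False
  then have "d mod 3 = 0" using d(2) by linarith
  have "d \<noteq> 0" using e adj_not_same by (cases d) auto
  have len: "length xs = d + (length xs - d)" using d(1) by simp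
  show ?thesis
  proof (rule good_coloring_chord_0[OF hamiltonian_cycle_rotate[OF xs, of "i + d"]])
    have "i + d + (length xs - d) = i + length xs" using d(1) by simp
    then have "(i + d + (length xs - d)) mod length xs = i" using d(1) by simp
    then show "rotate (i + d) xs ! 0 \<rightarrow> rotate (i + d) xs ! (length xs - d)"
      using d(1) \<open>d \<noteq> 0\<close> adj_sym[OF e] by (subst (1 2) nth_rotate) auto
    have "(d + (length xs - d)) mod 3 = (length xs - d) mod 3"
      using \<open>d mod 3 = 0\<close> by (metis add_0 mod_add_left_eq)
    then show "(length xs - d) mod 3 = 2" using n(1) len by simp
  qed (use n d(1) \<open>d \<noteq> 0\<close> in auto)
qed

text \<open>
  The colors go around the cycle as 0, 1, 2 up to position 4 and backwards afterwards, so that only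
  the two turning points 0 and 4 are not rainbow.
\<close>
lemma good_coloring_non_chord:
  assumes "hamiltonian_cycle xs" "length xs mod 3 = 2" "length xs \<ge> 8"
    and "\<not> xs ! 0 \<rightarrow> xs ! 4"
  shows "\<exists>c. good_coloring c"
proof -
  let ?n = "length xs"
  have n: "2 \<le> ?n" "1 < ?n" "6 < ?n" using assms(3) by linarith+
  note ends = mod_3_pred_eq_1[OF n(1) assms(2)]
  \<comment> \<open>Both branches give 1 at position 4, so any three consecutive positions not
    centered at 4 are described by a single branch.\<close>
  define g :: "nat \<Rightarrow> nat" where "g i = (if i \<le> 4 then i mod 3 else 2 - i mod 3)" for i
  have g: "g i = i mod 3" if "i \<le> 4" for i
    using that by (simp add: g_def)
  have g': "g i = 2 - i mod 3" if "4 \<le> i" for i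
    using that by (cases "i = 4") (simp_all add: g_def)
  have g_ends: "g 0 = 0" "g (?n - 1) = 1" "g (?n - 2) = 2"
    using n ends by (auto simp: g_def)
  obtain c where "\<forall>i<?n. c (xs ! i) = g i"
    using hamiltonian_cycle_coloring[OF assms(1), of g] ..
  then have c: "\<And>i. i < ?n \<Longrightarrow> c (xs ! i) = g i" by simp
  have r: "rainbow c (xs ! (?n - 1))"
    by (rule hamiltonian_cycle_rainbow_last[where c = c and g = g, OF assms(1)])
       (simp_all add: c g_ends g_ends[simplified] n[simplified])
  have "good_coloring c"
  proof (rule hamiltonian_cycle_good_coloringI[OF assms(1), of 0 4])
    fix i assume i: "i < ?n" "i \<noteq> 0" "i \<noteq> 4"
    show "rainbow c (xs ! i)"
    proof (cases "i = ?n - 1")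
      case False
      obtain j where j: "i = Suc j" using i(2) by (cases i) auto
      have lt: "Suc (Suc j) < ?n" using i j False by linarith
      have "j \<le> 2 \<or> 4 \<le> j" using i j by linarith
      then have "g j < 3 \<and> g (Suc j) < 3 \<and> g (Suc (Suc j)) < 3 \<and> g j \<noteq> g (Suc j) \<and>
        g j \<noteq> g (Suc (Suc j)) \<and> g (Suc j) \<noteq> g (Suc (Suc j))"
      proof
        assume "j \<le> 2"
        then have "g j = j mod 3" "g (Suc j) = Suc j mod 3" "g (Suc (Suc j)) = Suc (Suc j) mod 3"
          by (intro g; simp)+
        then show ?thesis by (metis mod_3_distinct mod_less_divisor zero_less_numeral)
      next
        assume "4 \<le> j"
        then show ?thesis by (auto simp: g' mod_Suc)
      qed
      with lt show ?thesis unfolding j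
        by (intro hamiltonian_cycle_rainbow[where c = c and g = g, OF assms(1)]) (simp_all add: c)
    qed (use r in simp)
  qed (use assms in auto)
  then show ?thesis by blast
qed

lemma good_coloring_mod_3_eq_2:
  assumes xs: "hamiltonian_cycle xs" and n: "length xs mod 3 = 2" "length xs \<ge> 8"
  shows "\<exists>c. good_coloring c"
proof (cases "xs ! 0 \<rightarrow> xs ! 4 \<and> xs ! 1 \<rightarrow> xs ! 5 \<and> xs ! 2 \<rightarrow> xs ! 6")
  case False
  then have "\<exists>i<3. \<not> xs ! i \<rightarrow> xs ! (i + 4)"
    by (auto simp: numeral_eq_Suc All_less_Suc Ex_less_Suc)
  then obtain i where i: "i < 3" "\<not> xs ! i \<rightarrow> xs ! (i + 4)" by blast
  show ?thesis
  proof (rule good_coloring_non_chord[OF hamiltonian_cycle_rotate[OF xs, of i]])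
    show "\<not> rotate i xs ! 0 \<rightarrow> rotate i xs ! 4"
      using i n by (subst (1 2) nth_rotate) auto
  qed (use n in auto)
next
  case True
  obtain v0 v1 v2 v3 v4 v5 v6 v7 vs where eq: "xs = v0 # v1 # v2 # v3 # v4 # v5 # v6 # v7 # vs"
  proof -
    have "\<exists>a ys. zs = a # ys \<and> length ys = m" if "length zs = Suc m" for zs :: "'a list" and m
      using that by (cases zs) auto
    moreover obtain m where "length xs = Suc (Suc (Suc (Suc (Suc (Suc (Suc (Suc m)))))))"
      using le_Suc_ex[OF n(2)] by (auto simp: numeral_eq_Suc)
    ultimately show ?thesis using that by metis
  qed
  \<comment> \<open>The segment from \<open>v1\<close> to \<open>v4\<close> is reversed, using the
    chords from \<open>v0\<close> to \<open>v4\<close> and from \<open>v1\<close> to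
    \<open>v5\<close>. The chord from \<open>v2\<close> to \<open>v6\<close> then joins positions 3
    and 6, whose distance is divisible by 3.\<close>
  let ?ys = "v0 # v4 # v3 # v2 # v1 # v5 # v6 # v7 # vs"
  have chords: "v0 \<rightarrow> v4" "v1 \<rightarrow> v5" "v2 \<rightarrow> v6"
    using True by (simp_all add: eq numeral_eq_Suc)
  have ys: "hamiltonian_cycle ?ys"
    using xs chords unfolding hamiltonian_cycle_def eq
    by (auto intro: adj_sym)
  show ?thesis
    by (rule good_coloring_chord[OF ys, of 3 3]) (use n chords in \<open>auto simp: eq\<close>)
qed

section \<open>Recognizing the cycle of length 5\<close>

text \<open>Without parallel arcs an arc is determined by its ends, so the vertex bijection induces
  the one on arcs.\<close>

lemma digraph_iso_with_proj:
  assumes h: "bij_betw h (verts G) (pverts H)"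
    and "\<And>u v. u \<in> verts G \<Longrightarrow> v \<in> verts G \<Longrightarrow> u \<rightarrow> v \<longleftrightarrow> (h u, h v) \<in> parcs H"
    and H: "parcs H \<subseteq> pverts H \<times> pverts H"
  shows "digraph_iso G (with_proj H)"
proof -
  define f where "f = \<lparr>iso_verts = h, iso_arcs = (\<lambda>a. (h (tail G a), h (head G a))),
    iso_head = snd, iso_tail = fst\<rparr>"
  have inj: "inj_on h (verts G)" using h by (rule bij_betw_imp_inj_on)
  have "inj_on (iso_arcs f) (arcs G)"
  proof (rule inj_onI)
    fix a b assume ab: "a \<in> arcs G" "b \<in> arcs G" "iso_arcs f a = iso_arcs f b"
    then have "h (tail G a) = h (tail G b)" "h (head G a) = h (head G b)"
      by (simp_all add: f_def)
    then have "tail G a = tail G b" "head G a = head G b"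
      using ab(1,2) by (simp_all add: inj_on_eq_iff[OF inj])
    with ab show "a = b" by (intro no_multi_arcs) (auto simp: arc_to_ends_def)
  qed
  then have "digraph_isomorphism f"
    using inj wf_digraph by (auto simp: digraph_isomorphism_def f_def)
  moreover have "iso_arcs f ` arcs G = parcs H"
  proof (intro equalityI subsetI)
    fix e assume "e \<in> iso_arcs f ` arcs G"
    then obtain a where a: "a \<in> arcs G" "e = (h (tail G a), h (head G a))" by (auto simp: f_def)
    then show "e \<in> parcs H"
      using assms(2)[of "tail G a" "head G a"] by (auto simp: arcs_ends_conv)
  next
    fix e assume e: "e \<in> parcs H"
    with H have "fst e \<in> h ` verts G" "snd e \<in> h ` verts G"
      unfolding bij_betw_imp_surj_on[OF h] by auto
    then obtain u v where uv: "u \<in> verts G" "v \<in> verts G" "e = (h u, h v)"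
      by (metis imageE prod.collapse)
    with e have "u \<rightarrow> v" using assms(2)[OF uv(1,2)] by simp
    then show "e \<in> iso_arcs f ` arcs G"
      using uv(3) by (auto simp: f_def arcs_ends_conv)
  qed
  then have "with_proj H = app_iso f G"
    using bij_betw_imp_surj_on[OF h] by (simp add: app_iso_def with_proj_def, simp add: f_def)
  ultimately show ?thesis unfolding digraph_iso_def by blast
qed

text \<open>The chord distances 2 and 3 both differ from 1 modulo 3, so any chord would yield a good
  coloring. Without chords the graph is the excluded cycle.\<close>

lemma good_coloring_order_5:
  assumes xs: "hamiltonian_cycle xs" and n: "length xs = 5"
    and "\<not> digraph_iso G (with_proj (cycle_graph 5))"
  shows "\<exists>c. good_coloring c"
proof (rule ccontr)
  assume none: "\<nexists>c. good_coloring c"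
  have no_chord: "\<not> xs ! i \<rightarrow> xs ! (i + d)" if "i + d < 5" "d mod 3 \<noteq> 1" for i d
  proof
    assume "xs ! i \<rightarrow> xs ! (i + d)"
    then have "\<exists>c. good_coloring c"
      using good_coloring_chord[OF xs, of i d] that n by simp
    with none show False by contradiction
  qed
  have cyc: "xs ! i \<rightarrow> xs ! j \<longleftrightarrow> j = Suc i \<or> (i = 0 \<and> j = 4)" if "i < j" "j < 5" for i j
  proof -
    obtain d where d: "j = i + d" using le_Suc_ex[OF less_imp_le[OF \<open>i < j\<close>]] by blast
    then have "0 < d" "i + d < 5" using that by simp_all
    then have "d = 1 \<or> d = 2 \<or> d = 3 \<or> i = 0 \<and> d = 4" by presburger
    then show ?thesis
    proof (elim disjE conjE)
      assume "d = 1"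
      then show ?thesis using that d hamiltonian_cycle_nth_Suc[OF xs, of i] n by simp
    next
      assume "i = 0" "d = 4"
      then show ?thesis using d adj_sym[OF hamiltonian_cycle_close[OF xs]] n by simp
    qed (use that d no_chord[of i d] in auto)
  qed
  have bij: "bij_betw ((!) xs) {..<5} (verts G)"
    using bij_betw_nth[of xs "{..<5}" "verts G"] xs n by (auto simp: hamiltonian_cycle_def)
  define h where "h = the_inv_into {..<5} ((!) xs)"
  have h: "bij_betw h (verts G) {..<5}"
    unfolding h_def by (rule bij_betw_the_inv_into[OF bij])
  have hx: "h (xs ! i) = i" if "i < 5" for i
    unfolding h_def using that bij by (simp add: bij_betw_def the_inv_into_f_f)
  have "digraph_iso G (with_proj (cycle_graph 5))"
  proof (rule digraph_iso_with_proj[of h])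
    fix u v assume "u \<in> verts G" "v \<in> verts G"
    then have "u \<in> (!) xs ` {..<5}" "v \<in> (!) xs ` {..<5}"
      unfolding bij_betw_imp_surj_on[OF bij] .
    then obtain i j where ij: "i < 5" "u = xs ! i" "j < 5" "v = xs ! j"
      by (elim imageE) simp
    have "xs ! i \<rightarrow> xs ! j \<longleftrightarrow> j = (i + 1) mod 5 \<or> i = (j + 1) mod 5"
    proof (cases i j rule: linorder_cases)
      case less
      then have "xs ! i \<rightarrow> xs ! j \<longleftrightarrow> j = Suc i \<or> (i = 0 \<and> j = 4)"
        using cyc ij(3) by blast
      also have "\<dots> \<longleftrightarrow> j = (i + 1) mod 5 \<or> i = (j + 1) mod 5"
        using less ij(3) by (cases "j = 4") auto
      finally show ?thesis .
    next
      case equal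
      have "i \<noteq> (i + 1) mod 5" using ij(1) by presburger
      with equal show ?thesis using adj_not_same by auto
    next
      case greater
      have "xs ! i \<rightarrow> xs ! j \<longleftrightarrow> xs ! j \<rightarrow> xs ! i"
        by (rule iffI; erule adj_sym)
      also have "\<dots> \<longleftrightarrow> i = Suc j \<or> (j = 0 \<and> i = 4)"
        using cyc greater ij(1) by blast
      also have "\<dots> \<longleftrightarrow> j = (i + 1) mod 5 \<or> i = (j + 1) mod 5"
        using greater ij(1) by (cases "i = 4") auto
      finally show ?thesis .
    qed
    then show "u \<rightarrow> v \<longleftrightarrow> (h u, h v) \<in> parcs (cycle_graph 5)"
      using ij hx by (simp add: cycle_graph_def)
  qed (use h in \<open>auto simp: cycle_graph_def\<close>)
  with assms(3) show False ..
qed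

lemma good_coloring_hamiltonian:
  assumes "hamiltonian_cycle xs" "length xs \<ge> 3"
    and "\<not> digraph_iso G (with_proj (cycle_graph 5))"
  shows "\<exists>c. good_coloring c"
proof -
  have "length xs mod 3 = 0 \<or> length xs mod 3 = 1 \<or> length xs = 5 \<or>
    length xs mod 3 = 2 \<and> length xs \<ge> 8"
    using assms(2) by presburger
  then show ?thesis
  proof (elim disjE conjE)
    assume "length xs mod 3 = 0"
    then show ?thesis by (rule good_coloring_mod_3_eq_0[OF assms(1)])
  next
    assume "length xs mod 3 = 1"
    then show ?thesis using assms(2) by (rule good_coloring_mod_3_eq_1[OF assms(1)])
  next
    assume "length xs = 5"
    then show ?thesis using assms(3) by (rule good_coloring_order_5[OF assms(1)])
  next
    assume "length xs mod 3 = 2" "8 \<le> length xs"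
    then show ?thesis by (rule good_coloring_mod_3_eq_2[OF assms(1)])
  qed
qed

section \<open>Longest paths\<close>

lemma ex_longest_path:
  assumes "verts G \<noteq> {}"
  obtains xs where "distinct xs" "set xs \<subseteq> verts G" "successively (dominates G) xs" "xs \<noteq> []"
    "\<And>ys. distinct ys \<Longrightarrow> set ys \<subseteq> verts G \<Longrightarrow> successively (dominates G) ys \<Longrightarrow>
       length ys \<le> length xs"
proof -
  let ?P = "\<lambda>xs. distinct xs \<and> set xs \<subseteq> verts G \<and> successively (dominates G) xs"
  obtain v where v: "v \<in> verts G" using assms by blast
  have bound: "\<forall>ys. ?P ys \<longrightarrow> length ys < Suc (card (verts G))"
    by (metis card_mono distinct_card finite_verts le_imp_less_Suc)
  obtain xs where xs: "?P xs" "\<forall>ys. ?P ys \<longrightarrow> length ys \<le> length xs"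
    using ex_has_greatest_nat[of ?P "[v]" length, OF _ bound] v by auto
  have "xs \<noteq> []" using xs(2)[rule_format, of "[v]"] v by auto
  then show thesis using that xs by blast
qed

text \<open>The search starts at the second path vertex \<open>v\<close> with the first vertex
  \<open>r\<close> as its parent, so \<open>r\<close> may fail to be rainbow. By maximality the
  neighbors of \<open>r\<close> lie on the path, and none is its last vertex, so all of them are
  rainbow.\<close>

lemma good_coloring_non_hamiltonian:
  assumes conn: "connected G" and xs: "distinct xs" "set xs \<subseteq> verts G" "xs \<noteq> []"
    "successively (dominates G) xs"
    and max: "\<And>ys. distinct ys \<Longrightarrow> set ys \<subseteq> verts G \<Longrightarrow> successively (dominates G) ys \<Longrightarrow>
       length ys \<le> length xs"
    and ends: "\<not> last xs \<rightarrow> hd xs" and card: "card (verts G) \<ge> 3"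
  shows "\<exists>c. good_coloring c"
proof -
  obtain r rs where r: "xs = r # rs" using xs(3) by (cases xs) auto
  have nbr: "y \<in> set rs" "y \<noteq> last xs" if "r \<rightarrow> y" for y
  proof -
    have "y \<in> set xs"
    proof (rule ccontr)
      assume "y \<notin> set xs"
      with max[of "y # xs"] xs that adj_sym[OF that] adj_in_verts[OF that] r show False by auto
    qed
    then show "y \<in> set rs" using r that adj_not_same by auto
    show "y \<noteq> last xs" using ends that adj_sym r by auto
  qed
  have "rs \<noteq> []"
  proof
    assume "rs = []"
    then have "{r} = verts G"
      using connected_closed[OF conn, of "{r}" r] xs(2) nbr r by auto
    with card show False by (metis card_1_singleton_iff One_nat_def numeral_le_one_iff semiring_norm(70))
  qed
  then obtain v vs where v: "rs = v # vs" by (cases rs) auto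
  let ?U = "verts G - {r, v}"
  \<comment> \<open>For vertices other than \<open>v\<close>, color 1 is only a placeholder until
    the search reaches them.\<close>
  let ?c = "(\<lambda>_. 1)(r := 0) :: 'a \<Rightarrow> nat"
  have rv: "r \<rightarrow> v" "r \<noteq> v" using xs r v by auto
  have "\<exists>W c. dfs_extension ?U v ?c vs W c"
  proof (rule ex_dfs_extension[of ?U v r ?c vs])
    show "successively (dominates G) (v # vs)" using xs(4) r v by simp
  qed (use xs(1,2) r v rv adj_sym[OF rv(1)] in auto)
  then obtain W c where ext: "dfs_extension ?U v ?c vs W c" by blast
  note W = dfs_extensionD(1,2,4-6)[OF ext]
  have r_nbr: "rainbow c y" if "r \<rightarrow> y" for y
  proof -
    have "y \<in> set (v # vs)" "y \<noteq> last (v # vs)" using nbr[OF that] r v by auto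
    then have "y \<in> set (butlast (v # vs))"
      by (metis append_butlast_last_id in_set_conv_decomp list.distinct(1) set_ConsD rotate1.simps(2) set_rotate1)
    then show ?thesis by (rule W(5))
  qed
  \<comment> \<open>Nothing is missed: the neighbors of \<open>r\<close> lie on the path, hence in
    \<open>insert v W\<close>, and the search from \<open>v\<close> is exhaustive.\<close>
  have "insert r (insert v W) = verts G"
  proof (rule connected_closed[OF conn, of _ r])
    fix x y assume x: "x \<in> insert r (insert v W)" and e: "x \<rightarrow> y"
    show "y \<in> insert r (insert v W)"
    proof (cases "x = r")
      case True
      then show ?thesis using nbr(1)[of y] e W(2) v by auto
    next
      case False
      then show ?thesis using W(3)[of x y] x e adj_in_verts(2)[OF e] by auto
    qed
  qed (use W(1) xs r v in auto)
  then have "good_coloring c"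
    unfolding good_coloring_def
    using W(4) r_nbr adj_sym adj_in_verts by (metis insertE)
  then show ?thesis by blast
qed

lemma ex_good_coloring:
  assumes conn: "connected G" and card: "card (verts G) \<ge> 3"
    and "\<not> digraph_iso G (with_proj (cycle_graph 5))"
  shows "\<exists>c. good_coloring c"
proof -
  have "verts G \<noteq> {}" using card by auto
  then obtain xs where xs: "distinct xs" "set xs \<subseteq> verts G" "successively (dominates G) xs" "xs \<noteq> []"
    and max: "\<And>ys. distinct ys \<Longrightarrow> set ys \<subseteq> verts G \<Longrightarrow> successively (dominates G) ys \<Longrightarrow>
       length ys \<le> length xs"
    using ex_longest_path by blast
  show ?thesis
  proof (cases "last xs \<rightarrow> hd xs")
    case False
    then show ?thesis using good_coloring_non_hamiltonian[OF conn xs(1,2,4,3) max _ card] by blast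
  next
    case True
    have closed: "y \<in> set xs" if x: "x \<in> set xs" and e: "x \<rightarrow> y" for x y
    proof (rule ccontr)
      assume y: "y \<notin> set xs"
      obtain as bs where split: "xs = as @ x # bs" using x by (meson split_list)
      \<comment> \<open>Closing the path to a cycle, opening it after \<open>x\<close> and appending
        \<open>y\<close> gives a path with one more vertex.\<close>
      let ?ys = "bs @ (as @ [x]) @ [y]"
      have "successively (dominates G) ?ys"
        using True xs(3) e split
        by (cases as; cases "bs = []") (auto simp: successively_append_iff successively_Cons hd_append split: if_splits)
      moreover have "distinct ?ys" "set ?ys \<subseteq> verts G"
        using xs(1,2) y split adj_in_verts(2)[OF e] by auto
      ultimately show False using max[of ?ys] split by simp
    qed
    have "set xs = verts G"
      by (rule connected_closed[OF conn xs(2) hd_in_set[OF xs(4)]]) (rule closed)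
    with xs True have "hamiltonian_cycle xs" unfolding hamiltonian_cycle_def by auto
    moreover have "length xs \<ge> 3"
      using card xs(1) \<open>set xs = verts G\<close> distinct_card by metis
    ultimately show ?thesis using good_coloring_hamiltonian assms(3) by blast
  qed
qed

section \<open>From good colorings to partitions\<close>

text \<open>A rainbow vertex lies in the closed neighborhood of every color class. Vertices missed
  by some class are therefore not rainbow, hence pairwise nonadjacent.\<close>

lemma good_coloring_imp_partition:
  assumes "connected G" "card (verts G) \<ge> 3" "good_coloring c"
  shows "\<exists>A :: nat \<Rightarrow> 'a set.
           (\<forall>i\<in>{1..3}. A i \<noteq> {}) \<and>
           disjoint_family_on A {1..3} \<and>
           (\<Union>i\<in>{1..3}. A i) = verts G \<and>
           independent_set G (\<Union>i\<in>{1..3}. verts G - closed_neighborhood G (A i))"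
proof -
  \<comment> \<open>Classes 1, 2, 3 stand for colors 0, 1, 2. A coloring may take any natural
    values, and the minimum puts the larger ones into the last class.\<close>
  define A where "A i = {v \<in> verts G. min (c v) 2 = i - 1}" for i :: nat
  have near: "\<exists>w\<in>A i. w = v \<or> v \<rightarrow> w" if "rainbow c v" "v \<in> verts G" "i \<in> {1..3}" for v i
  proof -
    have "i - 1 < 3" using that(3) by auto
    with that(1) obtain w where w: "w = v \<or> v \<rightarrow> w" "c w = i - 1"
      unfolding rainbow_def by blast
    then have "w \<in> A i" using that(2,3) adj_in_verts(2) by (auto simp: A_def)
    with w show ?thesis by blast
  qed
  \<comment> \<open>Connectedness provides an edge, one of its ends is rainbow, and so every color
    occurs, which makes all classes nonempty.\<close>
  obtain u v where "u \<rightarrow> v"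
  proof (rule ccontr)
    assume no: "\<not> thesis"
    obtain x where x: "x \<in> verts G" using assms(2) by (metis card.empty equals0I not_numeral_le_zero)
    have "{x} = verts G"
      by (rule connected_closed[OF assms(1)]) (use x no that in auto)
    then have "card (verts G) = 1" by (metis card_1_singleton_iff One_nat_def)
    with assms(2) show False by simp
  qed
  with assms(3) have "\<exists>v\<in>verts G. rainbow c v"
    unfolding good_coloring_def using adj_in_verts by blast
  then have "\<forall>i\<in>{1..3}. A i \<noteq> {}" using near by blast
  moreover have "disjoint_family_on A {1..3}"
    by (auto simp: disjoint_family_on_def A_def)
  moreover have "(\<Union>i\<in>{1..3}. A i) = verts G"
  proof -
    have "v \<in> (\<Union>i\<in>{1..3}. A i)" if "v \<in> verts G" for v
      using that by (intro UN_I[of "Suc (min (c v) 2)"]) (auto simp: A_def)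
    then show ?thesis by (auto simp: A_def)
  qed
  moreover have "\<not> rainbow c v"
    if "v \<in> (\<Union>i\<in>{1..3}. verts G - closed_neighborhood G (A i))" for v
    using that near adj_sym unfolding closed_neighborhood_def by blast
  then have "independent_set G (\<Union>i\<in>{1..3}. verts G - closed_neighborhood G (A i))"
    using assms(3) unfolding independent_set_def good_coloring_def by blast
  ultimately show ?thesis by blast
qed

end

theorem theorem2:
  fixes G :: "('a, 'b) pre_digraph"
  assumes "graph G"
    and "connected G"
    and "card (verts G) \<ge> 3"
    and "\<not> digraph_iso G (with_proj (cycle_graph 5))"
  shows "\<exists>A :: nat \<Rightarrow> 'a set.
           (\<forall>i\<in>{1..3}. A i \<noteq> {}) \<and>
           disjoint_family_on A {1..3} \<and>
           (\<Union>i\<in>{1..3}. A i) = verts G \<and>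
           independent_set G (\<Union>i\<in>{1..3}. verts G - closed_neighborhood G (A i))"
  using graph.ex_good_coloring[OF assms] graph.good_coloring_imp_partition[OF assms(1-3)] by blast

end
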